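(* Let $\{c_n\}_{n=1}^\infty$ be a real sequence, let $\{d_{n+1}\}_{n=1}^\infty$ be a positive chain sequence, and let $\mathcal{W}_n$ be given on $[-1,1]$ by $$\mathcal{W}_{n+1}(x)=\big(x-c_{n+1}\sqrt{1-x^2}\big)\mathcal{W}_n(x)-d_{n+1}\mathcal{W}_{n-1}(x),\quad n\ge0,\qquad \mathcal{W}_{-1}=0,\ \mathcal{W}_0=1.$$ Let $N\ge2$ and $(A,B)\subseteq(-1,1)$ with $A<B$. Then the zeros of $\mathcal{W}_n$, $1\le n\le N$, all belong to $(A,B)$ if and only if both of the following hold: (a) $\dfrac{A}{\sqrt{1-A^2}}<c_1<\dfrac{B}{\sqrt{1-B^2}}$; (b) $\{\mathfrak{d}_{n+1}(x)\}_{n=1}^{N-1}$ is a finite positive chain sequence for $x=A$ and for $x=B$, where $$\mathfrak{d}_{n+1}(x)=\frac{d_{n+1}}{(x-c_n\sqrt{1-x^2})(x-c_{n+1}\sqrt{1-x^2})}.$$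
   Context: Positive chain sequence: $\{d_{n+1}\}_{n\ge1}$ such that there is $\{g_n\}_{n\ge1}$ with $0\le g_1<1$, $0<g_n<1$ for $n\ge2$, and $d_{n+1}=(1-g_n)g_{n+1}$ for all $n\ge1$. A finite sequence $\{d_{n+1}\}_{n=1}^{N-1}$ is a finite positive chain sequence if there are $g_1,\dots,g_N$ with $0\le g_1<1$, $0<g_n<1$ for $2\le n\le N$, and $d_{n+1}=(1-g_n)g_{n+1}$ for $1\le n\le N-1$. In (a), the value $A/\sqrt{1-A^2}$ for $A=-1$ is $-\infty$, and $B/\sqrt{1-B^2}$ for $B=1$ is $+\infty$. Condition (b) includes that the quantities $\mathfrak{d}_{n+1}(A)$, $\mathfrak{d}_{n+1}(B)$ are well defined (nonzero denominators). (Each $\mathcal{W}_n$, $n\ge1$, has exactly $n$ zeros, all in $(-1,1)$.) *)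

theory Defs
  imports Complex_Main "HOL-Library.Extended_Real"
begin

text \<open>
  All sequences are functions on \<^typ>\<open>nat\<close> indexed by the subscripts used in the mathematics:
  \<open>c 1, c 2, \<dots>\<close>, \<open>d 2, d 3, \<dots>\<close> and \<open>g 1, g 2, \<dots>\<close>; the values at smaller indices are never used.
\<close>

definition positive_chain_sequence :: "(nat \<Rightarrow> real) \<Rightarrow> bool" where
  "positive_chain_sequence d \<longleftrightarrow>
     (\<exists>g :: nat \<Rightarrow> real. 0 \<le> g 1 \<and> g 1 < 1 \<and>
        (\<forall>n\<ge>2. 0 < g n \<and> g n < 1) \<and>
        (\<forall>n\<ge>1. d (n + 1) = (1 - g n) * g (n + 1)))"

text \<open>The finite sequence in question is \<open>d 2, \<dots>, d N\<close>, with parameters \<open>g 1, \<dots>, g N\<close>.\<close>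

definition finite_positive_chain_sequence :: "nat \<Rightarrow> (nat \<Rightarrow> real) \<Rightarrow> bool" where
  "finite_positive_chain_sequence N d \<longleftrightarrow>
     (\<exists>g :: nat \<Rightarrow> real. 0 \<le> g 1 \<and> g 1 < 1 \<and>
        (\<forall>n\<in>{2..N}. 0 < g n \<and> g n < 1) \<and>
        (\<forall>n\<in>{1..N-1}. d (n + 1) = (1 - g n) * g (n + 1)))"

text \<open>
  The second equation is the recurrence at \<open>n = 0\<close>, where \<open>\<W>\<^sub>-\<^sub>1 = 0\<close> removes the last term.
  The functions are meaningful on \<open>[-1, 1]\<close> only: outside, \<^const>\<open>sqrt\<close> takes a
  negative argument.
\<close>

fun W :: "(nat \<Rightarrow> real) \<Rightarrow> (nat \<Rightarrow> real) \<Rightarrow> nat \<Rightarrow> real \<Rightarrow> real" where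
  "W c d 0 x = 1"
| "W c d (Suc 0) x = x - c 1 * sqrt (1 - x\<^sup>2)"
| "W c d (Suc (Suc n)) x =
     (x - c (n + 2) * sqrt (1 - x\<^sup>2)) * W c d (Suc n) x - d (n + 2) * W c d n x"

definition frakd_denom :: "(nat \<Rightarrow> real) \<Rightarrow> nat \<Rightarrow> real \<Rightarrow> real" where
  "frakd_denom c k x =
     (x - c (k - 1) * sqrt (1 - x\<^sup>2)) * (x - c k * sqrt (1 - x\<^sup>2))"

text \<open>
  Like \<open>d\<close>, this is indexed by the full subscript \<open>k = n + 1\<close> with \<open>n \<ge> 1\<close>, so that \<open>k - 1\<close>
  is \<open>n\<close>. Division by zero is total in HOL; that the denominators do not vanish has to be
  required separately.
\<close>

definition frakd :: "(nat \<Rightarrow> real) \<Rightarrow> (nat \<Rightarrow> real) \<Rightarrow> nat \<Rightarrow> real \<Rightarrow> real" where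
  "frakd c d k x = d k / frakd_denom c k x"

text \<open>
  \<open>x / sqrt (1 - x\<^sup>2)\<close> for \<open>-1 \<le> x \<le> 1\<close>, with its infinite limits as values at the end points.
\<close>

definition endpoint_ratio :: "real \<Rightarrow> ereal" where
  "endpoint_ratio x =
     (if x = -1 then -\<infinity> else if x = 1 then \<infinity> else ereal (x / sqrt (1 - x\<^sup>2)))"

end

theory Submission
  imports Defs
begin

text \<open>
  On \<open>[B, 1]\<close> the absence of zeros amounts to \<open>W\<^sub>n(B) > 0\<close> for all \<open>n \<le> N\<close>, because
  \<open>W\<^sub>n(1) > 0\<close> and because positivity at \<open>B\<close> propagates to the right. For the latter, let
  \<open>\<rho>\<^sub>n(x) = W\<^sub>n(x) / (\<surd>(1 - x\<^sup>2) W\<^sub>n\<^sub>-\<^sub>1(x))\<close>. In terms of \<open>t = x / \<surd>(1 - x\<^sup>2)\<close> and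
  \<open>\<sigma> = 1 / \<surd>(1 - x\<^sup>2)\<close> it satisfies \<open>\<rho>\<^sub>n\<^sub>+\<^sub>1 = t - c\<^sub>n\<^sub>+\<^sub>1 - d\<^sub>n\<^sub>+\<^sub>1 \<sigma>\<^sup>2 / \<rho>\<^sub>n\<close>. Since \<open>\<sigma>\<close> is a
  1-Lipschitz function of \<open>t\<close>, the convexity inequality
  \<open>(a + b)\<^sup>2 / (p + q) \<le> a\<^sup>2 / p + b\<^sup>2 / q\<close> and the parameters \<open>g\<^sub>n\<close> of \<open>d\<close> give
  \<open>\<rho>\<^sub>n(y) \<ge> \<rho>\<^sub>n(x) + (t(y) - t(x)) (1 - g\<^sub>n)\<close> for \<open>x < y\<close>. Positivity at a point is in turn a
  chain sequence condition, the parameters being \<open>1 - W\<^sub>n / ((x - c\<^sub>n \<surd>(1 - x\<^sup>2)) W\<^sub>n\<^sub>-\<^sub>1)\<close>. The left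
  end point follows by the reflection \<open>x \<mapsto> -x\<close>, \<open>c \<mapsto> -c\<close>.
\<close>

section \<open>Chain sequences, reflection and end points\<close>

lemma positive_chain_sequence_pos:
  assumes "positive_chain_sequence d" "n \<ge> 2"
  shows "d n > 0"
proof -
  obtain g :: "nat \<Rightarrow> real" where g: "g 1 < 1" "\<And>n. n \<ge> 2 \<Longrightarrow> 0 < g n \<and> g n < 1"
      "\<And>n. n \<ge> 1 \<Longrightarrow> d (n + 1) = (1 - g n) * g (n + 1)"
    using assms(1) unfolding positive_chain_sequence_def by blast
  have "g (n - 1) < 1"
    using g(1) g(2)[of "n - 1"] assms(2) by (cases "n = 2") auto
  then show ?thesis
    using g(2)[of n] g(3)[of "n - 1"] assms(2) by simp
qed

lemma positive_chain_sequence_imp_finite: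
  "positive_chain_sequence d \<Longrightarrow> finite_positive_chain_sequence N d"
  unfolding positive_chain_sequence_def finite_positive_chain_sequence_def by fastforce

lemma continuous_on_W: "continuous_on S (W c d n)"
  by (induction n rule: induct_nat_012) (auto intro!: continuous_intros)

lemma W_reflect: "W (\<lambda>n. - c n) d n (- x) = (- 1) ^ n * W c d n x"
  by (induction n rule: induct_nat_012) (simp_all add: algebra_simps)

lemma frakd_denom_reflect: "frakd_denom (\<lambda>n. - c n) k (- x) = frakd_denom c k x"
  by (simp add: frakd_denom_def algebra_simps)

lemma frakd_reflect: "frakd (\<lambda>n. - c n) d k (- x) = frakd c d k x"
  by (simp add: frakd_def frakd_denom_reflect)

lemma endpoint_ratio_minus: "endpoint_ratio (- x) = - endpoint_ratio x"
  by (auto simp: endpoint_ratio_def)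

text \<open>Clear the positive root. At \<open>x = 1\<close> both sides hold: the ratio is infinite
  and the root vanishes.\<close>

lemma less_endpoint_ratio_iff:
  assumes "- 1 < x" "x \<le> 1"
  shows "ereal a < endpoint_ratio x \<longleftrightarrow> 0 < x - a * sqrt (1 - x\<^sup>2)"
proof (cases "x = 1")
  case False
  then have "x\<^sup>2 < 1"
    using assms by (simp add: abs_square_less_1)
  then show ?thesis
    using assms False by (simp add: endpoint_ratio_def pos_less_divide_eq)
qed (simp add: endpoint_ratio_def)

section \<open>Positivity at a point as a chain sequence condition\<close>

lemma W_pos_imp_linear_pos:
  assumes d: "\<And>n. n \<ge> 2 \<Longrightarrow> d n > 0"
    and W: "\<And>n. n \<le> N \<Longrightarrow> W c d n x > 0"
    and n: "1 \<le> n" "n \<le> N"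
  shows "x - c n * sqrt (1 - x\<^sup>2) > 0"
proof (cases "n = 1")
  case True
  then show ?thesis using W[of 1] n by simp
next
  case False
  then obtain m where m: "n = Suc (Suc m)"
    using n by (metis One_nat_def Suc_le_D not_less_eq_eq le_antisym nat.exhaust)
  \<comment> \<open>Solved for its product term, the recurrence exhibits that product as a sum of
    positive terms.\<close>
  have "0 < W c d n x + d n * W c d m x"
    using W[of n] W[of m] d[of n] m n by (intro add_pos_pos mult_pos_pos) auto
  also have "\<dots> = (x - c n * sqrt (1 - x\<^sup>2)) * W c d (Suc m) x"
    using m by simp
  finally show ?thesis
    using W[of "Suc m"] m n by (simp add: zero_less_mult_iff)
qed

lemma W_pos_imp_finite_chain:
  assumes d: "\<And>n. n \<ge> 2 \<Longrightarrow> d n > 0"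
    and W: "\<And>n. n \<le> N \<Longrightarrow> W c d n x > 0"
  shows "finite_positive_chain_sequence N (\<lambda>k. frakd c d k x)"
proof -
  define u where "u n = x - c n * sqrt (1 - x\<^sup>2)" for n
  define g where "g n = 1 - W c d n x / (u n * W c d (n - 1) x)" for n
  have u: "u n > 0" if "1 \<le> n" "n \<le> N" for n
    using W_pos_imp_linear_pos[OF d W that] by (simp add: u_def)
  have W2: "W c d (Suc (Suc m)) x = u (Suc (Suc m)) * W c d (Suc m) x - d (Suc (Suc m)) * W c d m x" for m
    by (simp add: u_def)
  have g_Suc: "g (Suc (Suc m)) = d (Suc (Suc m)) * W c d m x / (u (Suc (Suc m)) * W c d (Suc m) x)"
    if "Suc (Suc m) \<le> N" for m
    using u[of "Suc (Suc m)"] W[of "Suc m"] that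
    unfolding g_def W2 by (simp add: field_simps del: W.simps)
  \<comment> \<open>For \<open>N = 0\<close> nothing is known about \<open>u 1\<close>, and
    \<open>g 1\<close> would be 1 if \<open>u 1 = 0\<close>, by division by zero; that case gets
    other parameters below.\<close>
  have g1: "g 1 = 0 \<or> N = 0"
    using u[of 1] by (cases N) (auto simp: g_def u_def)
  have lt1: "g n < 1" if "1 \<le> n" "n \<le> N" for n
    using u[OF that] W[of n] W[of "n - 1"] that by (simp add: g_def)
  have pos: "0 < g n" if "2 \<le> n" "n \<le> N" for n
  proof -
    obtain m where m: "n = Suc (Suc m)"
      using le_Suc_ex[OF \<open>2 \<le> n\<close>] by auto
    show ?thesis
      using that d[of n] u[of n] W[of m] W[of "Suc m"] g_Suc[of m] m by simp
  qed
  have rec: "frakd c d (n + 1) x = (1 - g n) * g (n + 1)" if "1 \<le> n" "n \<le> N - 1" for n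
  proof -
    obtain m where m: "n = Suc m"
      using \<open>1 \<le> n\<close> by (auto dest!: Suc_le_D)
    have le: "Suc (Suc m) \<le> N" using that m by simp
    show ?thesis
      using le u[of n] u[of "Suc n"] W[of n] W[of m]
      unfolding m g_Suc[OF le] Suc_eq_plus1[symmetric]
      unfolding g_def frakd_def frakd_denom_def u_def[symmetric]
      by (simp add: m field_simps del: W.simps)
  qed
  show ?thesis
  proof (cases "N = 0")
    case True
    then show ?thesis
      unfolding finite_positive_chain_sequence_def by (intro exI[of _ "\<lambda>_. 0"]) simp
  next
    case False
    then show ?thesis
      unfolding finite_positive_chain_sequence_def
      using g1 lt1 pos rec by (intro exI[of _ g]) auto
  qed
qed

text \<open>The bound \<open>W\<^sub>n \<ge> (1 - g\<^sub>n) u\<^sub>n W\<^sub>n\<^sub>-\<^sub>1\<close> expresses that the minimal parameters of a chain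
  sequence lie below all other parameters.\<close>

lemma finite_chain_imp_W_pos:
  assumes d: "\<And>n. n \<ge> 2 \<Longrightarrow> d n > 0"
    and u1: "0 < x - c 1 * sqrt (1 - x\<^sup>2)"
    and denom: "\<And>n. 1 \<le> n \<Longrightarrow> n \<le> N - 1 \<Longrightarrow> frakd_denom c (n + 1) x \<noteq> 0"
    and chain: "finite_positive_chain_sequence N (\<lambda>k. frakd c d k x)"
    and "n \<le> N"
  shows "W c d n x > 0"
proof -
  define u where "u n = x - c n * sqrt (1 - x\<^sup>2)" for n
  obtain g :: "nat \<Rightarrow> real" where g1: "0 \<le> g 1" "g 1 < 1"
    and g: "\<And>n. 2 \<le> n \<Longrightarrow> n \<le> N \<Longrightarrow> 0 < g n \<and> g n < 1"
    and rec: "\<And>n. 1 \<le> n \<Longrightarrow> n \<le> N - 1 \<Longrightarrow> frakd c d (n + 1) x = (1 - g n) * g (n + 1)"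
    using chain unfolding finite_positive_chain_sequence_def by auto
  have key: "Suc m \<le> N \<Longrightarrow> u (Suc m) > 0 \<and> W c d m x > 0 \<and>
      W c d (Suc m) x \<ge> (1 - g (Suc m)) * u (Suc m) * W c d m x \<and> g (Suc m) < 1" for m
  proof (induction m)
    case 0
    then show ?case
      using u1 g1 by (simp add: u_def mult_left_le_one_le)
  next
    case (Suc m)
    then have IH: "u (Suc m) > 0" "W c d m x > 0"
      "W c d (Suc m) x \<ge> (1 - g (Suc m)) * u (Suc m) * W c d m x" "g (Suc m) < 1"
      by auto
    have g': "0 < g (Suc (Suc m))" "g (Suc (Suc m)) < 1"
      using g[of "Suc (Suc m)"] Suc.prems by auto
    have eq: "d (Suc (Suc m)) / (u (Suc m) * u (Suc (Suc m))) = (1 - g (Suc m)) * g (Suc (Suc m))"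
      using rec[of "Suc m"] Suc.prems by (simp add: frakd_def frakd_denom_def u_def)
    \<comment> \<open>As \<open>d\<close> is positive, a positive quotient forces consecutive
      factors \<open>u\<close> to share their sign, which spreads from \<open>u 1\<close>.\<close>
    then have "d (Suc (Suc m)) / (u (Suc m) * u (Suc (Suc m))) > 0"
      using g' IH by simp
    then have u': "u (Suc (Suc m)) > 0"
      using IH d[of "Suc (Suc m)"] by (simp add: zero_less_divide_iff zero_less_mult_iff)
    have Wp: "W c d (Suc m) x > 0"
      using IH by (smt (verit) mult_pos_pos)
    have "d (Suc (Suc m)) = (1 - g (Suc m)) * g (Suc (Suc m)) * (u (Suc m) * u (Suc (Suc m)))"
      using eq IH(1) u' by (simp add: divide_eq_eq)
    then have "d (Suc (Suc m)) * W c d m x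
        = g (Suc (Suc m)) * u (Suc (Suc m)) * ((1 - g (Suc m)) * u (Suc m) * W c d m x)"
      by simp
    also have "\<dots> \<le> g (Suc (Suc m)) * u (Suc (Suc m)) * W c d (Suc m) x"
      using IH(3) g' u' by (intro mult_left_mono) auto
    finally show ?case
      using Wp u' g' by (simp add: u_def algebra_simps)
  qed
  show ?thesis
  proof (cases n)
    case (Suc m)
    then show ?thesis
      using key[of m] \<open>n \<le> N\<close> by (smt (verit) mult_pos_pos)
  qed simp
qed

text \<open>At 1 the root vanishes, so every linear factor is 1 and \<open>frakd\<close> reduces to
  \<open>d\<close> itself.\<close>

lemma W_one_pos:
  assumes "positive_chain_sequence d"
  shows "W c d n 1 > 0"
  using assms
  by (intro finite_chain_imp_W_pos[where N = n])
     (auto simp: positive_chain_sequence_pos frakd_denom_def frakd_def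
           intro: positive_chain_sequence_imp_finite)

section \<open>Propagation of positivity to the right\<close>

lemma square_add_divide_le:
  fixes a b p q :: real
  assumes "p > 0" "q > 0"
  shows "(a + b)\<^sup>2 / (p + q) \<le> a\<^sup>2 / p + b\<^sup>2 / q"
proof -
  have "a\<^sup>2 / p + b\<^sup>2 / q - (a + b)\<^sup>2 / (p + q) = (a * q - b * p)\<^sup>2 / (p * q * (p + q))"
    using assms by (simp add: divide_simps add_pos_pos) algebra
  also have "\<dots> \<ge> 0" using assms by simp
  finally show ?thesis by simp
qed

text \<open>With \<open>t = x / s\<close> one has \<open>1 / s = sqrt (1 + t\<^sup>2)\<close>. The
  right side minus the left is \<open>2 * (1 - x * y) / (r * s) - 2\<close>, and
  \<open>r * s + x * y \<le> 1\<close> by Cauchy-Schwarz.\<close>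

lemma inverse_sqrt_lipschitz:
  fixes x y :: real
  assumes "\<bar>x\<bar> < 1" "\<bar>y\<bar> < 1"
  defines "s \<equiv> sqrt (1 - x\<^sup>2)" and "r \<equiv> sqrt (1 - y\<^sup>2)"
  shows "(1 / r - 1 / s)\<^sup>2 \<le> (y / r - x / s)\<^sup>2"
proof -
  have sq: "s\<^sup>2 = 1 - x\<^sup>2" "r\<^sup>2 = 1 - y\<^sup>2" and pos: "s > 0" "r > 0"
    using assms by (simp_all add: s_def r_def abs_square_less_1 less_imp_le)
  have "2 * (s * r) \<le> 2 * (1 - x * y)"
    using sum_squares_bound[of s r] sum_squares_bound[of x y] sq by simp
  then have "(1 - x * y) / (r * s) \<ge> 1"
    using pos by (simp add: field_simps)
  moreover have "(y / r - x / s)\<^sup>2 - (1 / r - 1 / s)\<^sup>2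
      = 2 * (1 - x * y) / (r * s) - (1 - y\<^sup>2) / r\<^sup>2 - (1 - x\<^sup>2) / s\<^sup>2"
    using pos by (simp add: field_simps power2_eq_square)
  moreover have "(1 - y\<^sup>2) / r\<^sup>2 = 1" "(1 - x\<^sup>2) / s\<^sup>2 = 1"
    using sq pos by (metis divide_self less_irrefl zero_less_power)+
  ultimately show ?thesis by linarith
qed

lemma W_ratio_rec:
  fixes x :: real
  defines "s \<equiv> sqrt (1 - x\<^sup>2)"
  assumes "s \<noteq> 0" "W c d n x \<noteq> 0" "W c d (Suc n) x \<noteq> 0"
  shows "W c d (Suc (Suc n)) x / (s * W c d (Suc n) x) =
    x / s - c (n + 2) - d (n + 2) * ((1 / s)\<^sup>2 / (W c d (Suc n) x / (s * W c d n x)))"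
proof -
  have rec: "W c d (Suc (Suc n)) x = (x - c (n + 2) * s) * W c d (Suc n) x - d (n + 2) * W c d n x"
    by (simp add: s_def)
  show ?thesis
    unfolding rec using assms(2-4) by (simp add: field_simps power2_eq_square del: W.simps)
qed

lemma W_pos_mono:
  assumes chain: "positive_chain_sequence d"
    and W: "\<And>n. n \<le> N \<Longrightarrow> W c d n x > 0"
    and xy: "- 1 < x" "x < y" "y < 1"
    and "n \<le> N"
  shows "W c d n y > 0"
proof -
  define s where "s = sqrt (1 - x\<^sup>2)"
  define r where "r = sqrt (1 - y\<^sup>2)"
  define e where "e = y / r - x / s"
  have pos: "s > 0" "r > 0"
    using xy by (simp_all add: s_def r_def abs_square_less_1)
  have lip: "(1 / r - 1 / s)\<^sup>2 \<le> e\<^sup>2"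
    unfolding e_def s_def r_def using xy by (intro inverse_sqrt_lipschitz) auto
  have e: "e > 0"
  proof -
    \<comment> \<open>This is the monotonicity of \<open>t\<close>. Squares are compared once the
      signs are known; for two negative points the order of the squares is reversed.\<close>
    have "x * r < y * s"
    proof (cases "0 \<le> x")
      case True
      have "(x * r)\<^sup>2 < (y * s)\<^sup>2"
        using xy True pos by (auto simp: s_def r_def power_mult_distrib abs_square_less_1 less_imp_le algebra_simps
          intro: power_strict_mono)
      then show ?thesis
        using xy True pos by (intro power2_less_imp_less[of _ "y * s"]) auto
    next
      case False
      show ?thesis
      proof (cases "0 \<le> y")
        case True
        have "x * r < 0" using False pos by (simp add: mult_neg_pos)
        also have "0 \<le> y * s" using True pos by simp
        finally show ?thesis .
      next
        case y: False
        have "(- y * s)\<^sup>2 < (- x * r)\<^sup>2"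
          using xy y pos power_strict_mono[of "- y" "- x" 2]
          by (auto simp: s_def r_def power_mult_distrib abs_square_less_1 less_imp_le algebra_simps)
        then have "- y * s < - x * r"
          using False pos by (intro power2_less_imp_less[of _ "- x * r"]) (auto simp: mult_nonpos_nonneg)
        then show ?thesis by simp
      qed
    qed
    then show ?thesis
      using pos by (simp add: e_def field_simps)
  qed
  obtain g :: "nat \<Rightarrow> real" where g1: "0 \<le> g 1" "g 1 < 1"
    and g: "\<And>n. 2 \<le> n \<Longrightarrow> 0 < g n \<and> g n < 1"
    and rec: "\<And>n. 1 \<le> n \<Longrightarrow> d (n + 1) = (1 - g n) * g (n + 1)"
    using chain unfolding positive_chain_sequence_def by blast
  have g01: "0 \<le> g n" "g n < 1" if "1 \<le> n" for n
    using g1 g[of n] that by (cases "n = 1"; force)+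
  \<comment> \<open>\<open>R m\<close> and \<open>T m\<close> are \<open>\<rho>\<close> with index
    \<open>m + 1\<close> at \<open>x\<close> and at \<open>y\<close>, hence the pairing with
    \<open>g (Suc m)\<close>.\<close>
  define R where "R m = W c d (Suc m) x / (s * W c d m x)" for m
  define T where "T m = W c d (Suc m) y / (r * W c d m y)" for m
  have key: "Suc m \<le> N \<Longrightarrow> W c d m y > 0 \<and> W c d (Suc m) y > 0 \<and>
      T m \<ge> R m + e * (1 - g (Suc m))" for m
  proof (induction m)
    case 0
    have "T 0 = R 0 + e"
      using pos by (simp add: T_def R_def e_def field_simps flip: s_def r_def)
    moreover have "R 0 > 0"
      using W[of 0] W[of 1] 0 pos by (simp add: R_def)
    ultimately have "T 0 \<ge> R 0 + e * (1 - g 1)" "T 0 > 0"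
      using e g1 by (auto simp: algebra_simps)
    then show ?case
      using pos by (simp add: T_def zero_less_divide_iff)
  next
    case (Suc m)
    \<comment> \<open>The gain of \<open>T m\<close> over \<open>R m\<close> guaranteed by the
      induction hypothesis; it serves as the second denominator in the convexity inequality.\<close>
    define q where "q = e * (1 - g (Suc m))"
    have IH: "W c d m y > 0" "W c d (Suc m) y > 0" "T m \<ge> R m + q"
      using Suc by (auto simp: q_def)
    have q: "q > 0" using e g01[of "Suc m"] by (simp add: q_def)
    have R: "R m > 0" "R (Suc m) > 0"
      using W[of m] W[of "Suc m"] W[of "Suc (Suc m)"] Suc.prems pos
      by (auto simp: R_def simp del: W.simps)
    have dpos: "d (m + 2) > 0"
      using chain by (intro positive_chain_sequence_pos) auto
    have "(1 / r)\<^sup>2 / T m \<le> (1 / s + (1 / r - 1 / s))\<^sup>2 / (R m + q)"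
      using IH(3) R q by (auto intro!: divide_left_mono)
    also have "\<dots> \<le> (1 / s)\<^sup>2 / R m + (1 / r - 1 / s)\<^sup>2 / q"
      using R q by (intro square_add_divide_le)
    also have "\<dots> \<le> (1 / s)\<^sup>2 / R m + e\<^sup>2 / q"
      using lip q by (intro add_left_mono divide_right_mono) auto
    finally have "d (m + 2) * ((1 / r)\<^sup>2 / T m) \<le> d (m + 2) * ((1 / s)\<^sup>2 / R m + e\<^sup>2 / q)"
      using dpos by (intro mult_left_mono) auto
    \<comment> \<open>The factor \<open>1 - g (Suc m)\<close> cancels. So of the fresh gain
      \<open>e\<close> in \<open>t\<close> exactly the share \<open>g (Suc (Suc m))\<close> is lost,
      and the bound reproduces itself.\<close>
    moreover have "d (m + 2) * (e\<^sup>2 / q) = e * g (Suc (Suc m))"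
      using rec[of "Suc m"] e g01[of "Suc m"] by (simp add: q_def power2_eq_square)
    moreover have "T (Suc m) = y / r - c (m + 2) - d (m + 2) * ((1 / r)\<^sup>2 / T m)"
      unfolding T_def r_def using IH pos by (intro W_ratio_rec) (auto simp: r_def)
    moreover have "R (Suc m) = x / s - c (m + 2) - d (m + 2) * ((1 / s)\<^sup>2 / R m)"
      unfolding R_def s_def using W[of m] W[of "Suc m"] Suc.prems pos
      by (intro W_ratio_rec) (auto simp: s_def)
    ultimately have bound: "T (Suc m) \<ge> R (Suc m) + e * (1 - g (Suc (Suc m)))"
      by (simp add: e_def algebra_simps)
    have "e * (1 - g (Suc (Suc m))) > 0"
      using e g01[of "Suc (Suc m)"] by simp
    then have "T (Suc m) > 0"
      using bound R by linarith
    then have "W c d (Suc (Suc m)) y > 0"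
      using IH(2) pos by (simp add: T_def zero_less_divide_iff del: W.simps)
        (smt (verit) mult_pos_pos)
    then show ?case
      using IH bound by blast
  qed
  show ?thesis
  proof (cases n)
    case (Suc m)
    then show ?thesis using key[of m] \<open>n \<le> N\<close> by simp
  qed simp
qed

section \<open>Zero-free intervals at the two ends\<close>

lemma W_nonzero_right_iff:
  assumes chain: "positive_chain_sequence d" and B: "- 1 < B" "B \<le> 1"
  shows "(\<forall>n\<in>{1..N}. \<forall>x\<in>{B..1}. W c d n x \<noteq> 0) \<longleftrightarrow> (\<forall>n\<le>N. W c d n B > 0)"
proof
  assume nz: "\<forall>n\<in>{1..N}. \<forall>x\<in>{B..1}. W c d n x \<noteq> 0"
  show "\<forall>n\<le>N. W c d n B > 0"
  proof (intro allI impI, rule ccontr)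
    fix n assume n: "n \<le> N" and "\<not> W c d n B > 0"
    then have "W c d n B \<le> 0" by simp
    then obtain x where "B \<le> x" "x \<le> 1" "W c d n x = 0"
      using IVT'[of "W c d n" B 0 1] W_one_pos[OF chain, of c n] B continuous_on_W by force
    then show False
      using nz n by (cases n) auto
  qed
next
  assume pos: "\<forall>n\<le>N. W c d n B > 0"
  show "\<forall>n\<in>{1..N}. \<forall>x\<in>{B..1}. W c d n x \<noteq> 0"
  proof (intro ballI)
    fix n x assume "n \<in> {1..N}" "x \<in> {B..1}"
    \<comment> \<open>The point 1 is separate because \<open>t\<close> is infinite there.\<close>
    then consider "x = B" | "x = 1" | "B < x" "x < 1" by fastforce
    then have "W c d n x > 0"
      using pos W_one_pos[OF chain] W_pos_mono[OF chain, of N c B x n] B \<open>n \<in> {1..N}\<close>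
      by cases auto
    then show "W c d n x \<noteq> 0" by simp
  qed
qed

lemma W_nonzero_right_iff_chain:
  assumes chain: "positive_chain_sequence d" and B: "- 1 < B" "B \<le> 1" and "N \<ge> 1"
  shows "(\<forall>n\<in>{1..N}. \<forall>x\<in>{B..1}. W c d n x \<noteq> 0) \<longleftrightarrow>
    ereal (c 1) < endpoint_ratio B \<and> (\<forall>n\<in>{1..N-1}. frakd_denom c (n + 1) B \<noteq> 0) \<and>
    finite_positive_chain_sequence N (\<lambda>k. frakd c d k B)"
proof -
  note d = positive_chain_sequence_pos[OF chain]
  have "ereal (c 1) < endpoint_ratio B \<and> (\<forall>n\<in>{1..N-1}. frakd_denom c (n + 1) B \<noteq> 0) \<and>
      finite_positive_chain_sequence N (\<lambda>k. frakd c d k B)"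
    if W: "\<And>n. n \<le> N \<Longrightarrow> W c d n B > 0"
  proof -
    have u: "B - c n * sqrt (1 - B\<^sup>2) > 0" if "1 \<le> n" "n \<le> N" for n
      using W_pos_imp_linear_pos[OF d W that] .
    have "frakd_denom c (n + 1) B \<noteq> 0" if "n \<in> {1..N-1}" for n
      using u[of n] u[of "n + 1"] that \<open>N \<ge> 1\<close> by (force simp: frakd_denom_def)
    then show ?thesis
      using u[of 1] W_pos_imp_finite_chain[OF d W] \<open>N \<ge> 1\<close> B
      by (simp add: less_endpoint_ratio_iff)
  qed
  moreover have "W c d n B > 0"
    if "ereal (c 1) < endpoint_ratio B" "\<forall>n\<in>{1..N-1}. frakd_denom c (n + 1) B \<noteq> 0"
      "finite_positive_chain_sequence N (\<lambda>k. frakd c d k B)" "n \<le> N" for n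
    using that B by (intro finite_chain_imp_W_pos[OF d]) (auto simp: less_endpoint_ratio_iff)
  ultimately show ?thesis
    unfolding W_nonzero_right_iff[OF chain B] by blast
qed

lemma W_nonzero_left_iff_chain:
  assumes chain: "positive_chain_sequence d" and A: "- 1 \<le> A" "A < 1" and "N \<ge> 1"
  shows "(\<forall>n\<in>{1..N}. \<forall>x\<in>{-1..A}. W c d n x \<noteq> 0) \<longleftrightarrow>
    endpoint_ratio A < ereal (c 1) \<and> (\<forall>n\<in>{1..N-1}. frakd_denom c (n + 1) A \<noteq> 0) \<and>
    finite_positive_chain_sequence N (\<lambda>k. frakd c d k A)"
proof -
  have "(\<forall>x\<in>{-1..A}. W c d n x \<noteq> 0) \<longleftrightarrow> (\<forall>x\<in>{-A..1}. W (\<lambda>n. - c n) d n x \<noteq> 0)" for n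
  proof -
    \<comment> \<open>Under reflection \<open>W\<close> changes only by the sign
      \<open>(- 1) ^ n\<close>, so its zeros are carried over.\<close>
    have "{-A..1} = uminus ` {-1..A}" by simp
    then show ?thesis by (simp add: W_reflect del: image_uminus_atLeastAtMost)
  qed
  moreover have "ereal (- c 1) < endpoint_ratio (- A) \<longleftrightarrow> endpoint_ratio A < ereal (c 1)"
    unfolding endpoint_ratio_minus uminus_ereal.simps(1)[symmetric] ereal_minus_less_minus ..
  ultimately show ?thesis
    using W_nonzero_right_iff_chain[OF chain, of "- A" N "\<lambda>n. - c n"] A \<open>N \<ge> 1\<close>
    by (simp add: frakd_denom_reflect frakd_reflect)
qed

theorem theorem4p1:
  fixes c d :: "nat \<Rightarrow> real" and N :: nat and A B :: real
  assumes "positive_chain_sequence d"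
    and "N \<ge> 2"
    and "A < B"
    and "{A<..<B} \<subseteq> {-1<..<1}"
  shows "(\<forall>n\<in>{1..N}. \<forall>x\<in>{-1..1}. W c d n x = 0 \<longrightarrow> x \<in> {A<..<B}) \<longleftrightarrow>
    (endpoint_ratio A < ereal (c 1) \<and> ereal (c 1) < endpoint_ratio B) \<and>
    (\<forall>x\<in>{A, B}. (\<forall>n\<in>{1..N-1}. frakd_denom c (n + 1) x \<noteq> 0) \<and>
       finite_positive_chain_sequence N (\<lambda>k. frakd c d k x))"
proof -
  have AB: "- 1 \<le> A" "A < 1" "- 1 < B" "B \<le> 1"
    using assms(3,4) by (auto simp: greaterThanLessThan_subseteq_greaterThanLessThan)
  have "(\<forall>x\<in>{-1..1}. W c d n x = 0 \<longrightarrow> x \<in> {A<..<B}) \<longleftrightarrow>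
      (\<forall>x\<in>{-1..A}. W c d n x \<noteq> 0) \<and> (\<forall>x\<in>{B..1}. W c d n x \<noteq> 0)" for n
    using AB by force
  then have "(\<forall>n\<in>{1..N}. \<forall>x\<in>{-1..1}. W c d n x = 0 \<longrightarrow> x \<in> {A<..<B}) \<longleftrightarrow>
      (\<forall>n\<in>{1..N}. \<forall>x\<in>{-1..A}. W c d n x \<noteq> 0) \<and> (\<forall>n\<in>{1..N}. \<forall>x\<in>{B..1}. W c d n x \<noteq> 0)"
    by blast
  also have "\<dots> \<longleftrightarrow>
      (endpoint_ratio A < ereal (c 1) \<and> ereal (c 1) < endpoint_ratio B) \<and>
      (\<forall>x\<in>{A, B}. (\<forall>n\<in>{1..N-1}. frakd_denom c (n + 1) x \<noteq> 0) \<and>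
         finite_positive_chain_sequence N (\<lambda>k. frakd c d k x))"
    using W_nonzero_left_iff_chain[OF assms(1) AB(1,2), of N c]
      W_nonzero_right_iff_chain[OF assms(1) AB(3,4), of N c] assms(2) by auto
  finally show ?thesis .
qed

end
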